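(* Let $G$ be a weighted digraph on $V=\{1,\dots,n\}$ with random walk Laplacian $\mathcal{L}=I-S$ and with exactly $k$ reaches $R_1,\dots,R_k$, having cabals $B_1,\dots,B_k$. Then the eigenvalue $0$ of $\mathcal{L}$ has algebraic and geometric multiplicity $k$. Moreover, the left kernel $\{p \text{ a row vector in } \mathbb{R}^n : p\mathcal{L}=0\}$ has a basis $\bar\gamma_1,\bar\gamma_2,\dots,\bar\gamma_k$ whose elements satisfy: (i) for all $i\in\{1,\dots,k\}$ and all $v\in\{1,\dots,n\}$, $\bar\gamma_i(v)\ge 0$; (ii) $\operatorname{supp}(\bar\gamma_i)=B_i$, where $\operatorname{supp}$ denotes the set of vertices on which the vector takes a positive value; (iii) $\sum_v \bar\gamma_i(v)=1$ for every $i$; (iv) the vectors $\{\bar\gamma_i\}_{i=1}^k$ are pairwise orthogonal.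
   Context: $G$ is a weakly connected (i.e. its underlying undirected graph is connected) weighted directed graph on $V=\{1,\dots,n\}$ with directed edge set $E\subseteq V\times V$; $ji\in E$ denotes an edge $j\to i$, carrying a weight $w_{ji}>0$. The adjacency matrix $Q$ has $Q_{ij}=w_{ji}$ if $ji\in E$ and $0$ otherwise; if row $i$ of $Q$ is zero, $Q_{ii}$ is replaced by $1$ (the result is still called $Q$). $D$ is the diagonal matrix with $D_{ii}=\sum_j Q_{ij}$, $S=D^{-1}Q$ (row stochastic), and $\mathcal{L}=I-S$ is the random walk Laplacian. Write $j\rightsquigarrow i$ if there is a directed path from $j$ to $i$. The reachable set of $j$ is $R(j)=\{j\}\cup\{i: j\rightsquigarrow i\}$. A reach is a set of the form $R(j)$ that is maximal with respect to inclusion among all reachable sets. The distinct reaches are listed as $R_1,\dots,R_k$. A root of $R_i$ is a vertex $r\in R_i$ with $R(r)=R_i$; the cabal $B_i$ of $R_i$ is the set of all its roots. *)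

theory Defs
  imports
    "Jordan_Normal_Form.Jordan_Normal_Form"
    "Jordan_Normal_Form.Matrix_Kernel"
    "Jordan_Normal_Form.Gauss_Jordan_Elimination"
    "Graph_Theory.Pair_Digraph"
    "Graph_Theory.Digraph_Component"
begin

section \<open>Weighted digraphs and their random walk Laplacian\<close>

text \<open>
  Vertices are numbered from 0, to agree with the indexing of matrices and vectors. An arc
  \<open>(j, i)\<close> is an edge from \<open>j\<close> to \<open>i\<close> of weight \<open>w j i\<close>; loops are allowed. Values of \<open>w\<close>
  outside the arc set are irrelevant.
\<close>

locale weighted_digraph = pair_wf_digraph G for G :: "nat pair_pre_digraph" +
  fixes n :: nat and w :: "nat \<Rightarrow> nat \<Rightarrow> real"
  assumes vertices: "pverts G = {0..<n}"
    and weight_pos: "\<And>j i. (j, i) \<in> parcs G \<Longrightarrow> w j i > 0"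
    and weakly_connected: "Digraph_Component.connected (with_proj G)"

text \<open>Row \<open>i\<close> collects the edges that point \<^emph>\<open>to\<close> \<open>i\<close>.\<close>

definition raw_adjacency_mat ::
    "nat pair_pre_digraph \<Rightarrow> nat \<Rightarrow> (nat \<Rightarrow> nat \<Rightarrow> real) \<Rightarrow> real mat" where
  "raw_adjacency_mat G n w = mat n n (\<lambda>(i, j). if (j, i) \<in> parcs G then w j i else 0)"

definition adjacency_mat ::
    "nat pair_pre_digraph \<Rightarrow> nat \<Rightarrow> (nat \<Rightarrow> nat \<Rightarrow> real) \<Rightarrow> real mat" where
  "adjacency_mat G n w = mat n n (\<lambda>(i, j).
     if i = j \<and> row (raw_adjacency_mat G n w) i = 0\<^sub>v n then 1
     else raw_adjacency_mat G n w $$ (i, j))"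

definition degree_mat ::
    "nat pair_pre_digraph \<Rightarrow> nat \<Rightarrow> (nat \<Rightarrow> nat \<Rightarrow> real) \<Rightarrow> real mat" where
  "degree_mat G n w = mat n n (\<lambda>(i, j).
     if i = j then (\<Sum>l<n. adjacency_mat G n w $$ (i, l)) else 0)"

definition random_walk_mat ::
    "nat pair_pre_digraph \<Rightarrow> nat \<Rightarrow> (nat \<Rightarrow> nat \<Rightarrow> real) \<Rightarrow> real mat" where
  "random_walk_mat G n w = the (mat_inverse (degree_mat G n w)) * adjacency_mat G n w"

definition random_walk_laplacian ::
    "nat pair_pre_digraph \<Rightarrow> nat \<Rightarrow> (nat \<Rightarrow> nat \<Rightarrow> real) \<Rightarrow> real mat" where
  "random_walk_laplacian G n w = 1\<^sub>m n - random_walk_mat G n w"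


section \<open>Reaches and cabals\<close>

definition reachable_set :: "'a pair_pre_digraph \<Rightarrow> 'a \<Rightarrow> 'a set" where
  "reachable_set G j = {j} \<union> {i. j \<rightarrow>\<^sup>+\<^bsub>with_proj G\<^esub> i}"

definition reaches :: "'a pair_pre_digraph \<Rightarrow> 'a set set" where
  "reaches G = {R \<in> reachable_set G ` pverts G. \<forall>v \<in> pverts G. \<not> R \<subset> reachable_set G v}"

definition cabal :: "'a pair_pre_digraph \<Rightarrow> 'a set \<Rightarrow> 'a set" where
  "cabal G R = {r \<in> R. reachable_set G r = R}"


section \<open>Multiplicities, left kernel, support\<close>

definition algebraic_multiplicity :: "'a :: field mat \<Rightarrow> 'a \<Rightarrow> nat" where
  "algebraic_multiplicity A e = Polynomial.order e (char_poly A)"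

text \<open>\<open>char_matrix A e\<close> is \<open>A - e I\<close>, so this is the dimension of the eigenspace of \<open>e\<close>.\<close>

definition geometric_multiplicity :: "'a :: field mat \<Rightarrow> 'a \<Rightarrow> nat" where
  "geometric_multiplicity A e = kernel_dim (char_matrix A e)"

definition left_kernel :: "'a :: field mat \<Rightarrow> 'a vec set" where
  "left_kernel A = {p \<in> carrier_vec (dim_row A). mat_of_row p * A = 0\<^sub>m 1 (dim_col A)}"

definition is_left_kernel_basis :: "'a :: field mat \<Rightarrow> 'a vec set \<Rightarrow> bool" where
  "is_left_kernel_basis A S \<longleftrightarrow>
     vectorspace.basis class_ring
       (module_vec TYPE('a) (dim_row A)\<lparr>carrier := left_kernel A\<rparr>) S"

definition vec_supp :: "real vec \<Rightarrow> nat set" where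
  "vec_supp p = {v. v < dim_vec p \<and> p $ v > 0}"


section \<open>Consistency of the definitions\<close>

lemma left_kernel_eq_mat_kernel_transpose: "left_kernel A = mat_kernel (transpose_mat A)"
proof -
  have "mat_of_row p * A = 0\<^sub>m 1 (dim_col A) \<longleftrightarrow> transpose_mat A *\<^sub>v p = 0\<^sub>v (dim_col A)"
    if p: "p \<in> carrier_vec (dim_row A)" for p
  proof -
    have "mat_of_row p * A = 0\<^sub>m 1 (dim_col A) \<longleftrightarrow> (\<forall>j < dim_col A. p \<bullet> col A j = 0)"
      using p by (auto simp: mat_eq_iff)
    also have "\<dots> \<longleftrightarrow> (\<forall>j < dim_col A. col A j \<bullet> p = 0)"
      using p by (metis carrier_vec_dim_vec col_dim comm_scalar_prod carrier_vecI)
    also have "\<dots> \<longleftrightarrow> transpose_mat A *\<^sub>v p = 0\<^sub>v (dim_col A)"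
      by (auto simp: vec_eq_iff)
    finally show ?thesis .
  qed
  then show ?thesis
    by (auto simp: left_kernel_def mat_kernel_def)
qed

lemma is_left_kernel_basis_iff:
  "is_left_kernel_basis A S \<longleftrightarrow> kernel.basis (dim_row A) (transpose_mat A) S"
  by (simp add: is_left_kernel_basis_def left_kernel_eq_mat_kernel_transpose)

context weighted_digraph
begin

lemma row_sum_pos:
  assumes i: "i < n"
  shows "(\<Sum>l<n. adjacency_mat G n w $$ (i, l)) > 0"
proof -
  let ?A = "raw_adjacency_mat G n w" and ?Q = "adjacency_mat G n w"
  have A_nonneg: "?A $$ (i, l) \<ge> 0" if "l < n" for l
    using i that weight_pos[of l i] by (auto simp: raw_adjacency_mat_def intro: less_imp_le)
  then have Q_nonneg: "?Q $$ (i, l) \<ge> 0" if "l < n" for l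
    using i that by (auto simp: adjacency_mat_def)
  have "\<exists>l<n. ?Q $$ (i, l) > 0"
  proof (cases "row ?A i = 0\<^sub>v n")
    case True
    then have "?Q $$ (i, i) > 0" using i by (simp add: adjacency_mat_def)
    with i show ?thesis by blast
  next
    case False
    have "dim_row ?A = n" "dim_col ?A = n" by (simp_all add: raw_adjacency_mat_def)
    with False i obtain l where l: "l < n" "?A $$ (i, l) \<noteq> 0"
      by (auto simp: vec_eq_iff)
    with A_nonneg[of l] have "?A $$ (i, l) > 0" by simp
    then have "?Q $$ (i, l) > 0" using False i l by (simp add: adjacency_mat_def)
    with l show ?thesis by blast
  qed
  then obtain l where "l < n" "?Q $$ (i, l) > 0" by blast
  then show ?thesis using Q_nonneg by (intro sum_pos2[of _ l]) auto
qed

lemma random_walk_mat_index: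
  assumes i: "i < n" and j: "j < n"
  shows "random_walk_mat G n w $$ (i, j) =
    adjacency_mat G n w $$ (i, j) / (\<Sum>l<n. adjacency_mat G n w $$ (i, l))"
proof -
  let ?D = "degree_mat G n w" and ?Q = "adjacency_mat G n w"
  define d where "d i = (\<Sum>l<n. ?Q $$ (i, l))" for i
  define E where "E = mat n n (\<lambda>(i, j). if i = j then 1 / d i else 0)"
  have D: "?D = mat n n (\<lambda>(i, j). if i = j then d i else 0)"
    unfolding degree_mat_def d_def by (rule eq_matI) auto
  have Dc: "?D \<in> carrier_mat n n" and Ec: "E \<in> carrier_mat n n" and Qc: "?Q \<in> carrier_mat n n"
    by (simp_all add: D E_def adjacency_mat_def)
  have d0: "d i \<noteq> 0" if "i < n" for i
    using row_sum_pos[OF that] by (simp add: d_def)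
  have diag: "(mat n n (\<lambda>(i, j). if i = j then f i else 0) * A) $$ (i, j) = f i * A $$ (i, j)"
    if "A \<in> carrier_mat n n" "i < n" "j < n" for f :: "nat \<Rightarrow> real" and A i j
  proof -
    have "(mat n n (\<lambda>(i, j). if i = j then f i else 0) * A) $$ (i, j) =
        (\<Sum>l\<in>{0..<n}. (if i = l then f i else 0) * A $$ (l, j))"
      using that by (auto simp: scalar_prod_def intro!: sum.cong)
    also have "\<dots> = (\<Sum>l\<in>{0..<n}. if i = l then f i * A $$ (l, j) else 0)"
      by (rule sum.cong) auto
    also have "\<dots> = f i * A $$ (i, j)"
      using that by simp
    finally show ?thesis .
  qed
  have DE: "?D * E = 1\<^sub>m n"
  proof (rule eq_matI)
    fix i j assume "i < dim_row (1\<^sub>m n :: real mat)" "j < dim_col (1\<^sub>m n :: real mat)"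
    then have ij: "i < n" "j < n" by simp_all
    show "(?D * E) $$ (i, j) = 1\<^sub>m n $$ (i, j)"
      unfolding D using diag[OF Ec ij, of d] ij d0[of i] by (cases "i = j") (simp_all add: E_def)
  qed (use Dc Ec in auto)
  have ED: "E * ?D = 1\<^sub>m n"
  proof (rule eq_matI)
    fix i j assume "i < dim_row (1\<^sub>m n :: real mat)" "j < dim_col (1\<^sub>m n :: real mat)"
    then have ij: "i < n" "j < n" by simp_all
    show "(E * ?D) $$ (i, j) = 1\<^sub>m n $$ (i, j)"
      unfolding E_def using diag[OF Dc ij, of "\<lambda>i. 1 / d i"] ij d0[of i] by (cases "i = j") (simp_all add: D)
  qed (use Dc Ec in auto)
  have "?D \<in> Units (ring_mat TYPE(real) n ())"
    unfolding Units_def ring_mat_def using Dc Ec DE ED by auto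
  with mat_inverse(1)[OF Dc, of "()"] obtain B where B: "mat_inverse ?D = Some B"
    by (cases "mat_inverse ?D") auto
  with mat_inverse(2)[OF Dc B] have "B * ?D = 1\<^sub>m n" and Bc: "B \<in> carrier_mat n n" by auto
  have "B = B * (?D * E)" using Bc by (simp add: DE)
  also have "\<dots> = B * ?D * E" by (rule assoc_mult_mat[OF Bc Dc Ec, symmetric])
  also have "\<dots> = E" using Ec \<open>B * ?D = 1\<^sub>m n\<close> by simp
  finally have "B = E" .
  then have "random_walk_mat G n w = E * ?Q"
    by (simp add: random_walk_mat_def B)
  moreover have "(E * ?Q) $$ (i, j) = ?Q $$ (i, j) / d i"
    unfolding E_def using diag[OF Qc i j, of "\<lambda>i. 1 / d i"] by simp
  ultimately show ?thesis by (simp add: d_def)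
qed

end

end

theory Submission
  imports Defs
begin

text \<open>
  The walk with transition matrix \<open>S\<close> steps from \<open>i\<close> to a vertex \<open>j\<close> with an arc \<open>j \<rightarrow> i\<close>, so it runs
  against the arcs; it stays at \<open>i\<close> if no arc enters \<open>i\<close>. A reach is maximal, so a predecessor of a root is again a root: a cabal cannot be
  left by the walk. Any two roots of the same reach reach each other, distinct cabals are disjoint, and
  every vertex lies in some reach, so the walk can get from it into a cabal. The cabals are
  thus the closed communicating classes of a finite Markov chain, and the row vectors \<open>p\<close> with
  \<open>p L = 0\<close> are exactly its invariant vectors, \<open>p S = p\<close>.

  \<^bold>\<open>The left kernel.\<close> If \<open>p\<close> is invariant, so is \<open>|p|\<close>: the triangle inequality gives \<open>|p| \<le> |p| S\<close>
  entrywise, and both sides have the same total because the rows of \<open>S\<close> sum to 1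
  (\<open>invariant_abs\<close>). For nonnegative invariant vectors, positivity spreads along transitions
  (\<open>invariant_pos_transitions\<close>). Moreover no mass flows into a closed class, for it could not flow
  out again, and hence a vertex outside a class from which the class is accessible carries no mass
  (\<open>invariant_zero_outside_closed_class\<close>). Every closed class carries an invariant probability
  vector (\<open>exists_invariant_distribution\<close>), whose support is the whole class when the class is
  communicating. These vectors have disjoint supports, which yields both orthogonality and
  independence. They span: an invariant \<open>p\<close> that vanishes at one chosen vertex of each class has
  \<open>|p|\<close> vanishing on all classes and hence everywhere (\<open>invariant_basis_of_closed_classes\<close>).

  \<^bold>\<open>The multiplicities.\<close> Over any field the algebraic and the geometric multiplicity of 0 agree for a
  matrix \<open>A\<close> such that \<open>p A A = 0\<close> implies \<open>p A = 0\<close>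
  (\<open>order_char_poly_eq_kernel_dim\<close>). The Laplacian satisfies this on both sides: if \<open>q = p L\<close> and
  \<open>q L = 0\<close>, then \<open>p S^m = p - m q\<close>, which stays bounded in \<open>m\<close> only for \<open>q = 0\<close>, and likewise for
  column vectors. Applying the criterion to \<open>L\<close> and to its transpose, which has the same
  characteristic polynomial, both multiplicities of \<open>L\<close> equal the dimension \<open>k\<close> of the left kernel.
\<close>

section \<open>Semisimplicity of the eigenvalue zero\<close>

lemma char_matrix_zero: "A \<in> carrier_mat n n \<Longrightarrow> char_matrix A 0 = A"
  by (rule eq_matI) (auto simp: char_matrix_def)

text \<open>
  For this matrix \<open>B\<close> the matrix \<open>x I - B\<close> is block triangular. Its lower right block \<open>x I\<close> contributes
  \<open>x^m\<close> to the determinant, and its upper left block contributes the characteristic polynomial of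
  \<open>X\<close>, which does not vanish at 0 because \<open>X\<close> is invertible.
\<close>

lemma order_char_poly_four_block_zero_rows:
  fixes X Y :: "'a :: field mat"
  assumes X: "X \<in> carrier_mat r r" and Y: "Y \<in> carrier_mat r m" and det: "det X \<noteq> 0"
  shows "Polynomial.order 0 (char_poly (four_block_mat X Y (0\<^sub>m m r) (0\<^sub>m m m))) = m"
proof -
  let ?B = "four_block_mat X Y (0\<^sub>m m r) (0\<^sub>m m m)"
  have "char_poly_matrix ?B = four_block_mat (char_poly_matrix X) (map_mat (\<lambda>a. [:- a:]) Y)
      (0\<^sub>m m r) ([:0, 1:] \<cdot>\<^sub>m 1\<^sub>m m)"
    using X Y by (intro eq_matI) (auto simp: char_poly_matrix_def)
  moreover have "char_poly_matrix X \<in> carrier_mat r r"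
    using X by (simp add: char_poly_matrix_def)
  ultimately have "char_poly ?B = char_poly X * [:0, 1:] ^ m"
    using det_four_block_mat_lower_left_zero[of "char_poly_matrix X" r "map_mat (\<lambda>a. [:- a:]) Y" m
        "0\<^sub>m m r" "[:0, 1:] \<cdot>\<^sub>m 1\<^sub>m m"] Y
    by (simp add: char_poly_def)
  moreover have "poly (char_poly X) 0 \<noteq> 0"
  proof -
    have "\<not> eigenvalue X 0"
      using det X by (simp add: eigenvalue_det[OF X] char_matrix_zero[OF X])
    then show ?thesis
      by (simp add: eigenvalue_root_char_poly[OF X])
  qed
  moreover have "Polynomial.order 0 ([:0, 1:] ^ m :: 'a poly) = m"
    using order_power_n_n[of 0 m] by simp
  ultimately show ?thesis
    by (metis (no_types, lifting) add_0 mult_eq_0_iff order_0I order_mult pCons_eq_0_iff poly_0 power_not_zero zero_neq_one)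
qed

text \<open>
  Let \<open>C = P A\<close> be the row echelon form of \<open>A\<close>, of rank \<open>r\<close>. Then \<open>C\<close> has \<open>n - r\<close> zero rows, and so has
  \<open>B = P A P\<^sup>-\<^sup>1\<close>, which has the shape treated above. Its upper left block \<open>X\<close> is invertible: if
  \<open>u X = 0\<close>, extend \<open>u\<close> by zeros to \<open>x\<close>; then \<open>x B\<close> lives on the last \<open>n - r\<close> coordinates, where all rows
  of \<open>B\<close> are zero, so \<open>x B B = 0\<close>. By hypothesis this forces \<open>x C = 0\<close>, and the pivots read off \<open>u = 0\<close>.
  The hypothesis speaks of row vectors, written as columns acted on by the transpose.
\<close>

lemma order_char_poly_eq_kernel_dim:
  fixes A :: "'a :: field mat"
  assumes A: "A \<in> carrier_mat n n"
    and semisimple: "\<And>p. p \<in> carrier_vec n \<Longrightarrow>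
      transpose_mat A *\<^sub>v (transpose_mat A *\<^sub>v p) = 0\<^sub>v n \<Longrightarrow> transpose_mat A *\<^sub>v p = 0\<^sub>v n"
  shows "Polynomial.order 0 (char_poly A) = kernel_dim A"
proof -
  define C where "C = gauss_jordan_single A"
  from gauss_jordan_single[OF A C_def[symmetric]] obtain P Q where
    CPA: "C = P * A" and P: "P \<in> carrier_mat n n" and Q: "Q \<in> carrier_mat n n"
    and PQ: "P * Q = 1\<^sub>m n" and QP: "Q * P = 1\<^sub>m n"
    and C: "C \<in> carrier_mat n n" and row: "row_echelon_form C" by auto
  obtain f where f: "pivot_fun C f n" using row C by (auto simp: row_echelon_form_def)
  have dC: "dim_row C = n" "dim_col C = n" using C by auto
  note piv = pivot_funD[OF dC(1) f]
  let ?D = "{i. i < n \<and> row C i \<noteq> 0\<^sub>v n}"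
  have D_iff: "row C i \<noteq> 0\<^sub>v n \<longleftrightarrow> f i < n" if i: "i < n" for i
  proof
    assume "f i < n"
    with piv(4)[OF i] have "row C i $ f i = 1" using i dC by simp
    with \<open>f i < n\<close> show "row C i \<noteq> 0\<^sub>v n" by auto
  next
    assume "row C i \<noteq> 0\<^sub>v n"
    then show "f i < n"
      using piv(1,2)[OF i] i dC by (auto simp: vec_eq_iff) (meson order.strict_trans2 linorder_not_less)
  qed
  have down: "f i < n" if "f j < n" "i \<le> j" "j < n" for i j
    using that(2,1,3)
  proof (induction rule: dec_induct)
    case (step k)
    have "f (Suc k) \<le> n" "f k \<le> n" using piv(1) step by auto
    then show ?case using piv(3)[of k] step by fastforce
  qed
  \<comment> \<open>The nonzero rows of an echelon form come first, so they are those with index below \<open>r\<close>.\<close>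
  define r where "r = (LEAST i. i \<notin> ?D)"
  have "n \<notin> ?D" by simp
  then have r: "r \<notin> ?D" "r \<le> n"
    unfolding r_def by (rule LeastI) (rule Least_le, simp)
  have less_r: "i \<in> ?D" if "i < r" for i
    using not_less_Least that unfolding r_def by blast
  have D: "?D = {..<r}"
  proof
    show "?D \<subseteq> {..<r}"
    proof
      fix i assume i: "i \<in> ?D"
      then have "i < n" "f i < n" using D_iff by auto
      show "i \<in> {..<r}"
      proof (rule ccontr)
        assume "i \<notin> {..<r}"
        then have "r \<le> i" by simp
        with \<open>i < n\<close> \<open>f i < n\<close> have "r < n" "f r < n" using down by auto
        with D_iff r(1) show False by blast
      qed
    qed
  qed (use less_r in blast)
  define m where "m = n - r"
  have n: "n = r + m" using \<open>r \<le> n\<close> by (simp add: m_def)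
  have dim: "kernel_dim A = m"
  proof -
    have "kernel_dim A = kernel.dim n A" using A by (simp add: kernel_dim_def)
    also have "\<dots> = kernel.dim n C"
      unfolding CPA mat_kernel_mult_eq[OF A P Q QP] ..
    also have "\<dots> = m"
      unfolding find_base_vectors(6)[OF row C] D by (simp add: m_def)
    finally show ?thesis .
  qed
  have C0: "C $$ (i, j) = 0" if "r \<le> i" "i < n" "j < n" for i j
  proof -
    have "i \<notin> ?D" unfolding D using that by simp
    then have "row C i = 0\<^sub>v n" using that by simp
    then have "row C i $ j = 0" using that by simp
    then show ?thesis using that dC by simp
  qed
  define B where "B = C * Q"
  have B: "B \<in> carrier_mat n n" using C Q by (simp add: B_def)
  define X where "X = mat r r (\<lambda>(i, j). B $$ (i, j))"
  define Y where "Y = mat r m (\<lambda>(i, j). B $$ (i, j + r))"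
  have B_blocks: "B = four_block_mat X Y (0\<^sub>m m r) (0\<^sub>m m m)"
  proof (rule eq_matI)
    fix i j assume "i < dim_row (four_block_mat X Y (0\<^sub>m m r) (0\<^sub>m m m))"
      and "j < dim_col (four_block_mat X Y (0\<^sub>m m r) (0\<^sub>m m m))"
    then have ij: "i < n" "j < n" by (auto simp: X_def n)
    moreover have "B $$ (i, j) = 0" if "r \<le> i"
      using ij that C0[OF that \<open>i < n\<close>] C Q dC by (auto simp: B_def scalar_prod_def intro!: sum.neutral)
    ultimately show "B $$ (i, j) = four_block_mat X Y (0\<^sub>m m r) (0\<^sub>m m m) $$ (i, j)"
      by (auto simp: X_def Y_def n)
  qed (use B in \<open>auto simp: X_def Y_def n\<close>)
  have CT0: "transpose_mat C *\<^sub>v x = 0\<^sub>v n"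
    if x: "x \<in> carrier_vec n" and x0: "\<And>i. i < r \<Longrightarrow> x $ i = 0" for x
  proof (rule eq_vecI)
    fix j assume "j < dim_vec (0\<^sub>v n :: 'a vec)"
    then have j: "j < n" by simp
    have "C $$ (i, j) * x $ i = 0" if "i < n" for i
      using C0[of i j] \<open>i < n\<close> j x0[of i] by (cases "i < r") auto
    then show "(transpose_mat C *\<^sub>v x) $ j = 0\<^sub>v n $ j"
      using x j dC by (auto simp: scalar_prod_def intro!: sum.neutral)
  qed (use dC in auto)
  \<comment> \<open>In row notation: \<open>p = x P\<close>, \<open>z = p A = x C\<close> and \<open>y = z P\<^sup>-\<^sup>1 = x B\<close>.\<close>
  have "det X \<noteq> 0"
  proof
    assume "det X = 0"
    moreover have Xt: "transpose_mat X \<in> carrier_mat r r" by (simp add: X_def)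
    ultimately obtain u where u: "u \<in> carrier_vec r" "u \<noteq> 0\<^sub>v r" "transpose_mat X *\<^sub>v u = 0\<^sub>v r"
      using det_0_iff_vec_prod_zero_field[OF Xt] det_transpose[of X r] by (auto simp: X_def)
    define x where "x = u @\<^sub>v 0\<^sub>v m"
    have x: "x \<in> carrier_vec n" using u by (simp add: x_def n)
    define p where "p = transpose_mat P *\<^sub>v x"
    have p: "p \<in> carrier_vec n" using P x by (simp add: p_def)
    define z where "z = transpose_mat A *\<^sub>v p"
    have z: "z \<in> carrier_vec n" using A p by (simp add: z_def)
    have zC: "z = transpose_mat C *\<^sub>v x"
      unfolding z_def p_def CPA transpose_mult[OF P A]
      using A P x by (simp add: assoc_mult_mat_vec[of _ n n _ n])
    define y where "y = transpose_mat Q *\<^sub>v z"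
    have y: "y \<in> carrier_vec n" using Q z by (simp add: y_def)
    have yB: "y = transpose_mat B *\<^sub>v x"
      unfolding y_def zC B_def transpose_mult[OF C Q]
      using C Q x by (simp add: assoc_mult_mat_vec[of _ n n _ n])
    have "y $ i = 0" if i: "i < r" for i
    proof -
      have "y $ i = (\<Sum>j\<in>{0..<n}. B $$ (j, i) * x $ j)"
        unfolding yB using B x i by (simp add: scalar_prod_def n)
      also have "\<dots> = (\<Sum>j\<in>{0..<r}. X $$ (j, i) * u $ j)"
        by (rule sum.mono_neutral_cong_right) (use u i in \<open>auto simp: x_def X_def n\<close>)
      also have "\<dots> = (transpose_mat X *\<^sub>v u) $ i"
        using u(1) i by (simp add: scalar_prod_def X_def)
      also have "\<dots> = 0" using u(3) i by simp
      finally show ?thesis .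
    qed
    then have "transpose_mat C *\<^sub>v y = 0\<^sub>v n" by (rule CT0[OF y])
    moreover have "transpose_mat C *\<^sub>v y = transpose_mat A *\<^sub>v z"
    proof -
      have "transpose_mat P *\<^sub>v y = transpose_mat (Q * P) *\<^sub>v z"
        unfolding y_def transpose_mult[OF Q P]
        using P Q z by (simp add: assoc_mult_mat_vec[of _ n n _ n])
      then have "transpose_mat P *\<^sub>v y = z" using z by (simp add: QP)
      then show ?thesis
        unfolding CPA transpose_mult[OF P A] using A P y
        by (simp add: assoc_mult_mat_vec[of _ n n _ n])
    qed
    ultimately have "z = 0\<^sub>v n" using semisimple[OF p] by (simp add: z_def)
    have "u $ i = 0" if i: "i < r" for i
    proof -
      have i_n: "i < n" "f i < n" using i less_r[OF i] D_iff n by auto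
      have "z $ f i = (\<Sum>j\<in>{0..<n}. C $$ (j, f i) * x $ j)"
        unfolding zC using C x i_n by (simp add: scalar_prod_def)
      also have "\<dots> = (\<Sum>j\<in>{i}. C $$ (j, f i) * x $ j)"
        by (rule sum.mono_neutral_right) (use piv(5) i_n in auto)
      also have "\<dots> = u $ i" using piv(4) i_n i u(1) by (simp add: x_def)
      finally show ?thesis using \<open>z = 0\<^sub>v n\<close> i_n by simp
    qed
    then have "u = 0\<^sub>v r" using u(1) by auto
    with u(2) show False by simp
  qed
  then have "Polynomial.order 0 (char_poly B) = m"
    unfolding B_blocks by (rule order_char_poly_four_block_zero_rows[rotated 2]) (auto simp: X_def Y_def)
  moreover have "char_poly B = char_poly A"
  proof (rule char_poly_similar)
    show "similar_mat B A"
      unfolding similar_mat_def similar_mat_wit_def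
      using A B P Q PQ QP by (intro exI[of _ P] exI[of _ Q]) (auto simp: B_def CPA Let_def)
  qed
  ultimately show ?thesis by (simp add: dim)
qed

section \<open>Bases read off from coordinates\<close>

text \<open>
  Each \<open>x \<in> X\<close> owns a coordinate \<open>r x\<close> at which all other members vanish; independence is
  immediate, and subtracting from a kernel vector the combination with the same coordinates leaves a
  vector that \<open>determined\<close> forces to be zero.
\<close>

lemma kernel_basis_if_dual_coordinates:
  fixes A :: "'a :: field mat"
  assumes A: "A \<in> carrier_mat nr nc" and fin: "finite X" and X: "X \<subseteq> mat_kernel A"
    and r: "\<And>x. x \<in> X \<Longrightarrow> r x < nc" "\<And>x. x \<in> X \<Longrightarrow> x $ r x \<noteq> 0"
    and dual: "\<And>x y. x \<in> X \<Longrightarrow> y \<in> X \<Longrightarrow> y \<noteq> x \<Longrightarrow> y $ r x = 0"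
    and determined: "\<And>v. v \<in> mat_kernel A \<Longrightarrow> (\<And>x. x \<in> X \<Longrightarrow> v $ r x = 0) \<Longrightarrow> v = 0\<^sub>v nc"
  shows "kernel.basis nc A X"
proof -
  interpret kernel nr nc A by unfold_locales (rule A)
  have coord: "lincomb a X $ r x = a x * x $ r x" if x: "x \<in> X" for a x
  proof -
    have "lincomb a X $ r x = (\<Sum>y\<in>X. a y * y $ r x)"
      by (rule lincomb_index[OF r(1)[OF x] X])
    also have "\<dots> = (\<Sum>y\<in>{x}. a y * y $ r x)"
      by (rule sum.mono_neutral_right) (use fin x dual in auto)
    finally show ?thesis by simp
  qed
  show ?thesis
    unfolding Ker.basis_def
  proof (intro conjI)
    show "\<not> lin_dep X"
    proof (rule Ker.finite_lin_indpt2[OF fin X], intro ballI)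
      fix a x assume "lincomb a X = 0\<^sub>v nc" and x: "x \<in> X"
      then have "lincomb a X $ r x = 0" using r(1) by simp
      with coord[OF x] r(2)[OF x] show "a x = 0" by simp
    qed
    show "span X = mat_kernel A"
    proof
      show "span X \<subseteq> mat_kernel A" using X by (rule Ker.span_is_subset2)
      show "mat_kernel A \<subseteq> span X"
      proof
        fix v assume v: "v \<in> mat_kernel A"
        define a where "a x = v $ r x / x $ r x" for x
        have l: "lincomb a X \<in> mat_kernel A" by (rule Ker.lincomb_closed[OF X]) auto
        note vc = mat_kernelD[OF A v] and lc = mat_kernelD[OF A l]
        have "v - lincomb a X = 0\<^sub>v nc"
        proof (rule determined)
          show "v - lincomb a X \<in> mat_kernel A"
            using vc lc A by (intro mat_kernelI[OF A]) (auto simp: mult_minus_distrib_mat_vec)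
          fix x assume x: "x \<in> X"
          have "(v - lincomb a X) $ r x = v $ r x - lincomb a X $ r x"
            using lc(1) r(1)[OF x] by (auto simp del: index_minus_vec simp: index_minus_vec(1))
          then show "(v - lincomb a X) $ r x = 0"
            using r(2)[OF x] by (simp add: coord[OF x] a_def)
        qed
        then have "v = lincomb a X"
          using vc(1) lc(1) by (simp add: vec_eq_iff)
        then show "v \<in> span X" using fin unfolding Ker.span_def by auto
      qed
    qed
  qed (rule X)
qed

section \<open>Invariant vectors of a stochastic matrix\<close>

lemma sum_of_bool_eq_mult:
  fixes f :: "nat \<Rightarrow> real"
  assumes "i < n"
  shows "(\<Sum>j<n. of_bool (i = j) * f j) = f i" "(\<Sum>j<n. f j * of_bool (j = i)) = f i"
proof -
  have "(\<Sum>j<n. of_bool (i = j) * f j) = (\<Sum>j<n. if i = j then f j else 0)"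
    "(\<Sum>j<n. f j * of_bool (j = i)) = (\<Sum>j<n. if i = j then f j else 0)"
    by (rule sum.cong; simp)+
  then show "(\<Sum>j<n. of_bool (i = j) * f j) = f i" "(\<Sum>j<n. f j * of_bool (j = i)) = f i"
    using assms by simp_all
qed

lemma zero_if_multiples_bounded:
  fixes a c :: real
  assumes "\<And>m :: nat. of_nat m * \<bar>a\<bar> \<le> c"
  shows "a = 0"
proof (rule ccontr)
  assume "a \<noteq> 0"
  then obtain m :: nat where "c < of_nat m * \<bar>a\<bar>"
    using reals_Archimedean3[of "\<bar>a\<bar>"] by auto
  with assms[of m] show False by simp
qed

locale stochastic_matrix =
  fixes n :: nat and S :: "nat \<Rightarrow> nat \<Rightarrow> real"
  assumes nonneg: "i < n \<Longrightarrow> j < n \<Longrightarrow> 0 \<le> S i j"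
    and row_sum: "i < n \<Longrightarrow> (\<Sum>j<n. S i j) = 1"
begin

definition invariant :: "(nat \<Rightarrow> real) \<Rightarrow> bool" where
  "invariant p \<longleftrightarrow> (\<forall>j<n. (\<Sum>i<n. p i * S i j) = p j)"

definition transitions :: "(nat \<times> nat) set" where
  "transitions = {(i, j). i < n \<and> j < n \<and> S i j > 0}"

definition closed_class :: "nat set \<Rightarrow> bool" where
  "closed_class C \<longleftrightarrow> C \<subseteq> {..<n} \<and> transitions `` C \<subseteq> C"

lemma total_mass_preserved: "(\<Sum>j<n. \<Sum>i<n. p i * S i j) = (\<Sum>i<n. p i)"
  by (subst sum.swap) (simp add: sum_distrib_left[symmetric] row_sum)

lemma abs_step_le:
  assumes "j < n"
  shows "\<bar>\<Sum>i<n. p i * S i j\<bar> \<le> (\<Sum>i<n. \<bar>p i\<bar> * S i j)"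
  using sum_abs[of "\<lambda>i. p i * S i j" "{..<n}"] assms by (simp add: abs_mult nonneg)

text \<open>
  Summed over \<open>j\<close>, the inequality \<open>|p j| \<le> (|p| S) j\<close> becomes an equality, so it is one for every \<open>j\<close>.
\<close>

lemma invariant_abs:
  assumes "invariant p"
  shows "invariant (\<lambda>i. \<bar>p i\<bar>)"
proof -
  let ?d = "\<lambda>j. (\<Sum>i<n. \<bar>p i\<bar> * S i j) - \<bar>p j\<bar>"
  have "(\<Sum>j<n. ?d j) = 0"
    by (simp add: sum_subtractf total_mass_preserved)
  moreover have "0 \<le> ?d j" if "j < n" for j
    using abs_step_le[OF that, of p] assms that by (simp add: invariant_def)
  ultimately have "\<forall>j<n. ?d j = 0"
    by (subst (asm) sum_nonneg_eq_0_iff) auto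
  then show ?thesis by (simp add: invariant_def)
qed

lemma invariant_pos_transitions:
  assumes inv: "invariant q" and q: "\<And>i. i < n \<Longrightarrow> 0 \<le> q i"
    and trans: "(i, j) \<in> transitions\<^sup>*" and pos: "0 < q i"
  shows "0 < q j"
  using trans
proof (induction rule: rtrancl_induct)
  case (step j l)
  then have *: "j < n" "l < n" "S j l > 0" by (auto simp: transitions_def)
  have "0 < (\<Sum>i<n. q i * S i l)"
    by (rule sum_pos2[of _ j]) (use * q nonneg step.IH in auto)
  also have "\<dots> = q l" using inv * by (simp add: invariant_def)
  finally show ?case .
qed (rule pos)

text \<open>
  The mass on \<open>C\<close> after one step is all the mass that was on \<open>C\<close>, since none leaves, plus the inflow
  from outside; invariance makes the inflow zero.
\<close>

lemma no_inflow:
  assumes inv: "invariant q" and q: "\<And>i. i < n \<Longrightarrow> 0 \<le> q i" and C: "closed_class C"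
    and i: "i < n" "i \<notin> C" "0 < q i" and trans: "(i, j) \<in> transitions"
  shows "j \<notin> C"
proof
  assume j: "j \<in> C"
  have sub: "C \<subseteq> {..<n}" and fin: "finite C"
    using C finite_subset by (auto simp: closed_class_def)
  \<comment> \<open>The probability of being in \<open>C\<close> after one step from \<open>i\<close>.\<close>
  define s where "s i = (\<Sum>j\<in>C. S i j)" for i
  have s1: "s i = 1" if "i \<in> C" for i
  proof -
    have "S i j = 0" if "j < n" "j \<notin> C" for j
      using C \<open>i \<in> C\<close> that nonneg[of i j] sub
      by (force simp: closed_class_def transitions_def)
    then have "s i = (\<Sum>j<n. S i j)"
      unfolding s_def using sub by (intro sum.mono_neutral_left) auto
    then show ?thesis using row_sum sub that by auto
  qed
  have s0: "0 \<le> s i" if "i < n" for i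
    unfolding s_def using sub that nonneg by (auto intro!: sum_nonneg)
  have "(\<Sum>j\<in>C. q j) = (\<Sum>j\<in>C. \<Sum>i<n. q i * S i j)"
    using inv sub by (intro sum.cong) (auto simp: invariant_def)
  also have "\<dots> = (\<Sum>i<n. q i * s i)"
    unfolding s_def by (subst sum.swap) (simp add: sum_distrib_left)
  also have "\<dots> = (\<Sum>i\<in>{..<n} - C. q i * s i) + (\<Sum>i\<in>C. q i * s i)"
    by (rule sum.subset_diff[OF sub]) simp
  also have "(\<Sum>i\<in>C. q i * s i) = (\<Sum>i\<in>C. q i)" by (simp add: s1)
  finally have "(\<Sum>i\<in>{..<n} - C. q i * s i) = 0" by simp
  then have "q i * s i = 0"
    using i q s0 by (subst (asm) sum_nonneg_eq_0_iff) force+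
  with i have "(\<Sum>j\<in>C. S i j) = 0" by (simp add: s_def)
  then have "S i j = 0"
    using fin sub nonneg i(1) j by (subst (asm) sum_nonneg_eq_0_iff) auto
  with trans show False by (simp add: transitions_def)
qed

text \<open>
  Were \<open>q i\<close> positive, \<open>q\<close> would stay positive along the path from \<open>i\<close> to \<open>j\<close>, whose first step into
  \<open>C\<close> would be a forbidden inflow.
\<close>

lemma invariant_zero_outside_closed_class:
  assumes inv: "invariant q" and q: "\<And>i. i < n \<Longrightarrow> 0 \<le> q i" and C: "closed_class C"
    and i: "i < n" "i \<notin> C" and trans: "(i, j) \<in> transitions\<^sup>*" and j: "j \<in> C"
  shows "q i = 0"
proof (rule ccontr)
  assume "q i \<noteq> 0"
  with q i have pos: "0 < q i" by fastforce
  from trans have "j \<notin> C \<and> j < n"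
  proof (induction rule: rtrancl_induct)
    case (step j l)
    then show ?case
      using no_inflow[OF inv q C _ _ invariant_pos_transitions[OF inv q step(1) pos] step(2)]
      by (auto simp: transitions_def)
  qed (use i in simp)
  with j show False by simp
qed

text \<open>
  Keep the rows of \<open>I - S\<close> that belong to \<open>C\<close> and replace the others by unit rows. The result \<open>M\<close>
  annihilates the indicator vector of \<open>C\<close>, because \<open>C\<close> is closed and the rows of \<open>S\<close> sum to 1; so \<open>M\<close>
  is singular and some \<open>p \<noteq> 0\<close> satisfies \<open>p M = 0\<close>. A column outside \<open>C\<close> is a unit column, which makes \<open>p\<close>
  vanish there; then \<open>p\<close> does not see the replaced rows and is invariant. Normalising \<open>|p|\<close> gives the
  distribution.
\<close>

lemma exists_invariant_distribution:
  assumes C: "closed_class C" "C \<noteq> {}"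
  obtains q where "invariant q" "\<And>i. i < n \<Longrightarrow> 0 \<le> q i" "\<And>i. i < n \<Longrightarrow> i \<notin> C \<Longrightarrow> q i = 0"
    "(\<Sum>i<n. q i) = 1"
proof -
  have sub: "C \<subseteq> {..<n}" using C by (simp add: closed_class_def)
  have S0: "S i j = 0" if "i \<in> C" "j < n" "j \<notin> C" for i j
    using C that nonneg[of i j] sub by (force simp: closed_class_def transitions_def)
  define \<delta> :: "nat \<Rightarrow> nat \<Rightarrow> real" where "\<delta> i j = of_bool (i = j)" for i j
  define M where "M = mat n n (\<lambda>(i, j). if i \<in> C then \<delta> i j - S i j else \<delta> i j)"
  have M: "M \<in> carrier_mat n n" by (simp add: M_def)
  define x where "x = vec n (\<lambda>i. of_bool (i \<in> C) :: real)"
  have x: "x \<in> carrier_vec n" by (simp add: x_def)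
  from C(2) sub obtain c where c: "c \<in> C" "c < n" by auto
  then have "x $ c \<noteq> 0\<^sub>v n $ c" by (simp add: x_def)
  then have "x \<noteq> 0\<^sub>v n" by metis
  have "(M *\<^sub>v x) $ i = 0" if i: "i < n" for i
  proof -
    have eq: "(M *\<^sub>v x) $ i = (\<Sum>j<n. M $$ (i, j) * of_bool (j \<in> C))"
      using i M by (simp add: x_def scalar_prod_def atLeast0LessThan)
    show ?thesis
    proof (cases "i \<in> C")
      case True
      have "(\<Sum>j<n. M $$ (i, j) * of_bool (j \<in> C)) = (\<Sum>j<n. \<delta> i j - S i j)"
        using True i S0[OF True] by (intro sum.cong) (auto simp: M_def \<delta>_def)
      also have "\<dots> = 0" using i by (simp add: sum_subtractf row_sum \<delta>_def of_bool_def)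
      finally show ?thesis using eq by simp
    next
      case False
      then show ?thesis unfolding eq
        using i by (intro sum.neutral) (auto simp: M_def \<delta>_def)
    qed
  qed
  then have "M *\<^sub>v x = 0\<^sub>v n" using M by (intro eq_vecI) auto
  with x \<open>x \<noteq> 0\<^sub>v n\<close> have "det (transpose_mat M) = 0"
    unfolding det_transpose[OF M] det_0_iff_vec_prod_zero_field[OF M] by blast
  then obtain v where v: "v \<in> carrier_vec n" "v \<noteq> 0\<^sub>v n" "transpose_mat M *\<^sub>v v = 0\<^sub>v n"
    using det_0_iff_vec_prod_zero_field[of "transpose_mat M" n] M by auto
  define p where "p i = v $ i" for i
  have M0: "(\<Sum>i<n. p i * M $$ (i, j)) = 0" if j: "j < n" for j
  proof -
    have "(\<Sum>i<n. p i * M $$ (i, j)) = (transpose_mat M *\<^sub>v v) $ j"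
      using j M v(1) by (simp add: scalar_prod_def atLeast0LessThan p_def mult.commute)
    then show ?thesis using v(3) j by simp
  qed
  have p0: "p j = 0" if j: "j < n" "j \<notin> C" for j
  proof -
    have "(\<Sum>i<n. p i * M $$ (i, j)) = (\<Sum>i<n. p i * \<delta> i j)"
      using j S0 by (intro sum.cong) (auto simp: M_def)
    also have "\<dots> = p j" using j by (simp add: \<delta>_def sum_of_bool_eq_mult)
    finally show ?thesis using M0 j by simp
  qed
  have "invariant p"
    unfolding invariant_def
  proof (intro allI impI)
    fix j assume j: "j < n"
    have "(\<Sum>i<n. p i * M $$ (i, j)) = (\<Sum>i<n. p i * \<delta> i j - p i * S i j)"
      using j p0 by (intro sum.cong) (auto simp: M_def algebra_simps)
    also have "\<dots> = p j - (\<Sum>i<n. p i * S i j)"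
      using j by (simp add: sum_subtractf \<delta>_def sum_of_bool_eq_mult)
    finally show "(\<Sum>i<n. p i * S i j) = p j" using M0[OF j] by simp
  qed
  then have inv: "invariant (\<lambda>i. \<bar>p i\<bar>)" by (rule invariant_abs)
  define t where "t = (\<Sum>i<n. \<bar>p i\<bar>)"
  have "t \<noteq> 0"
  proof
    assume "t = 0"
    then have "\<forall>i<n. p i = 0" unfolding t_def by (subst (asm) sum_nonneg_eq_0_iff) auto
    then have "v = 0\<^sub>v n" using v(1) by (intro eq_vecI) (auto simp: p_def)
    with v(2) show False by simp
  qed
  then have "t > 0" by (simp add: t_def sum_nonneg less_le)
  show ?thesis
  proof (rule that[of "\<lambda>i. \<bar>p i\<bar> / t"])
    show "invariant (\<lambda>i. \<bar>p i\<bar> / t)"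
      using inv by (simp add: invariant_def sum_divide_distrib[symmetric])
    show "(\<Sum>i<n. \<bar>p i\<bar> / t) = 1"
      using \<open>t \<noteq> 0\<close> by (simp add: sum_divide_distrib[symmetric] t_def[symmetric])
  qed (use p0 \<open>t > 0\<close> in auto)
qed

text \<open>
  The row vectors \<open>P m = p - m q\<close> satisfy \<open>P m S = P (m + 1)\<close>, and multiplication by \<open>S\<close> does not
  increase the sum of absolute values, so all multiples of \<open>q\<close> are bounded.
\<close>

lemma row_defect_zero_if_invariant:
  assumes q: "\<And>j. j < n \<Longrightarrow> q j = p j - (\<Sum>i<n. p i * S i j)" and inv: "invariant q" and j: "j < n"
  shows "q j = 0"
proof (rule zero_if_multiples_bounded)
  fix m :: nat
  define P where "P m j = p j - of_nat m * q j" for m j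
  have step: "(\<Sum>i<n. P m i * S i j) = P (Suc m) j" if "j < n" for m j
  proof -
    have "(\<Sum>i<n. P m i * S i j) = (\<Sum>i<n. p i * S i j) - of_nat m * (\<Sum>i<n. q i * S i j)"
      by (simp add: P_def algebra_simps sum_subtractf sum_distrib_left)
    also have "\<dots> = (p j - q j) - of_nat m * q j"
      using q[OF that] inv that by (simp add: invariant_def)
    finally show ?thesis by (simp add: P_def algebra_simps)
  qed
  have "(\<Sum>j<n. \<bar>P m j\<bar>) \<le> (\<Sum>j<n. \<bar>p j\<bar>)"
  proof (induction m)
    case (Suc m)
    have "(\<Sum>j<n. \<bar>P (Suc m) j\<bar>) \<le> (\<Sum>j<n. \<Sum>i<n. \<bar>P m i\<bar> * S i j)"
      using abs_step_le[of _ "P m"] by (intro sum_mono) (simp add: step)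
    with Suc show ?case by (simp add: total_mass_preserved)
  qed (simp add: P_def)
  moreover have "\<bar>P m j\<bar> \<le> (\<Sum>j<n. \<bar>P m j\<bar>)" "\<bar>p j\<bar> \<le> (\<Sum>j<n. \<bar>p j\<bar>)"
    using j by (auto intro!: member_le_sum)
  moreover have "of_nat m * \<bar>q j\<bar> = \<bar>p j - P m j\<bar>" by (simp add: P_def abs_mult)
  ultimately show "of_nat m * \<bar>q j\<bar> \<le> 2 * (\<Sum>j<n. \<bar>p j\<bar>)" by linarith
qed

text \<open>
  The dual of the preceding argument: averaging with the rows of \<open>S\<close> does not increase a bound on the
  absolute values of the entries.
\<close>

lemma column_defect_zero_if_harmonic:
  assumes g: "\<And>i. i < n \<Longrightarrow> g i = f i - (\<Sum>j<n. S i j * f j)"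
    and harm: "\<And>i. i < n \<Longrightarrow> (\<Sum>j<n. S i j * g j) = g i" and i: "i < n"
  shows "g i = 0"
proof (rule zero_if_multiples_bounded)
  fix m :: nat
  define F where "F m i = f i - of_nat m * g i" for m i
  define c where "c = (\<Sum>j<n. \<bar>f j\<bar>)"
  have step: "(\<Sum>j<n. S i j * F m j) = F (Suc m) i" if "i < n" for m i
  proof -
    have "(\<Sum>j<n. S i j * F m j) = (\<Sum>j<n. S i j * f j) - of_nat m * (\<Sum>j<n. S i j * g j)"
      by (simp add: F_def algebra_simps sum_subtractf sum_distrib_left)
    also have "\<dots> = (f i - g i) - of_nat m * g i"
      using g[OF that] harm[OF that] by simp
    finally show ?thesis by (simp add: F_def algebra_simps)
  qed
  have f: "\<bar>f i\<bar> \<le> c" if "i < n" for i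
    unfolding c_def using that by (auto intro!: member_le_sum)
  have "\<forall>i<n. \<bar>F m i\<bar> \<le> c"
  proof (induction m)
    case (Suc m)
    show ?case
    proof (intro allI impI)
      fix i assume i: "i < n"
      have "\<bar>F (Suc m) i\<bar> \<le> (\<Sum>j<n. \<bar>S i j * F m j\<bar>)"
        unfolding step[OF i, symmetric] by (rule sum_abs)
      also have "\<dots> \<le> (\<Sum>j<n. S i j * c)"
        using Suc i nonneg by (intro sum_mono) (auto simp: abs_mult intro!: mult_left_mono)
      also have "\<dots> = c" using i by (simp add: sum_distrib_right[symmetric] row_sum)
      finally show "\<bar>F (Suc m) i\<bar> \<le> c" .
    qed
  qed (use f in \<open>simp add: F_def\<close>)
  with i f have "\<bar>F m i\<bar> \<le> c" "\<bar>f i\<bar> \<le> c" by auto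
  moreover have "of_nat m * \<bar>g i\<bar> = \<bar>f i - F m i\<bar>" by (simp add: F_def abs_mult)
  ultimately show "of_nat m * \<bar>g i\<bar> \<le> 2 * c" by linarith
qed

section \<open>The Laplacian of a stochastic matrix\<close>

definition laplacian :: "real mat" where
  "laplacian = mat n n (\<lambda>(i, j). of_bool (i = j) - S i j)"

lemma laplacian_carrier [simp]: "laplacian \<in> carrier_mat n n"
  by (simp add: laplacian_def)

lemma laplacian_mult_vec:
  assumes "f \<in> carrier_vec n" "i < n"
  shows "(laplacian *\<^sub>v f) $ i = f $ i - (\<Sum>j<n. S i j * f $ j)"
proof -
  have "(laplacian *\<^sub>v f) $ i = (\<Sum>j<n. of_bool (i = j) * f $ j - S i j * f $ j)"
    using assms by (simp add: laplacian_def scalar_prod_def atLeast0LessThan left_diff_distrib)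
  then show ?thesis by (simp add: sum_subtractf sum_of_bool_eq_mult assms)
qed

lemma transpose_laplacian_mult_vec:
  assumes "p \<in> carrier_vec n" "j < n"
  shows "(transpose_mat laplacian *\<^sub>v p) $ j = p $ j - (\<Sum>i<n. p $ i * S i j)"
proof -
  have "(transpose_mat laplacian *\<^sub>v p) $ j = (\<Sum>i<n. p $ i * of_bool (i = j) - p $ i * S i j)"
    using assms
    by (simp add: laplacian_def scalar_prod_def atLeast0LessThan right_diff_distrib mult.commute)
  then show ?thesis by (simp add: sum_subtractf sum_of_bool_eq_mult assms)
qed

lemma mat_kernel_transpose_laplacian:
  "p \<in> mat_kernel (transpose_mat laplacian) \<longleftrightarrow> p \<in> carrier_vec n \<and> invariant (\<lambda>i. p $ i)"
proof -
  have "transpose_mat laplacian *\<^sub>v p = 0\<^sub>v n \<longleftrightarrow> invariant (\<lambda>i. p $ i)" if p: "p \<in> carrier_vec n"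
  proof -
    define z where "z = transpose_mat laplacian *\<^sub>v p"
    have "dim_vec z = n" by (simp add: z_def laplacian_def)
    then have "z = 0\<^sub>v n \<longleftrightarrow> (\<forall>j<n. z $ j = 0)" by (auto simp: vec_eq_iff)
    also have "\<dots> \<longleftrightarrow> invariant (\<lambda>i. p $ i)"
    proof -
      have "z $ j = 0 \<longleftrightarrow> (\<Sum>i<n. p $ i * S i j) = p $ j" if "j < n" for j
        using transpose_laplacian_mult_vec[OF p that] unfolding z_def by linarith
      then show ?thesis unfolding invariant_def by blast
    qed
    finally show ?thesis by (simp add: z_def)
  qed
  moreover have "dim_row laplacian = n" "dim_col laplacian = n" by (simp_all add: laplacian_def)
  ultimately show ?thesis by (auto simp: mat_kernel_def)
qed

text \<open>
  The second equation comes from applying the criterion to the transpose, where its hypothesis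
  is about column vectors. Together the equations identify the dimensions of the left and the right
  kernel.
\<close>

lemma order_char_poly_laplacian:
  "Polynomial.order 0 (char_poly laplacian) = kernel_dim laplacian"
  "Polynomial.order 0 (char_poly laplacian) = kernel_dim (transpose_mat laplacian)"
proof -
  let ?L = laplacian
  have c: "?L \<in> carrier_mat n n" "transpose_mat ?L \<in> carrier_mat n n" by simp_all
  show "Polynomial.order 0 (char_poly ?L) = kernel_dim ?L"
  proof (rule order_char_poly_eq_kernel_dim[OF c(1)])
    fix p assume p: "p \<in> carrier_vec n" and z: "transpose_mat ?L *\<^sub>v (transpose_mat ?L *\<^sub>v p) = 0\<^sub>v n"
    define q where "q = transpose_mat ?L *\<^sub>v p"
    have q: "q \<in> carrier_vec n" unfolding q_def by (rule mult_mat_vec_carrier[OF c(2) p])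
    have "q \<in> mat_kernel (transpose_mat ?L)"
      using q z by (intro mat_kernelI[OF c(2)]) (simp_all add: q_def)
    then have inv: "invariant (\<lambda>i. q $ i)" by (simp add: mat_kernel_transpose_laplacian)
    have q_eq: "q $ j = p $ j - (\<Sum>i<n. p $ i * S i j)" if "j < n" for j
      unfolding q_def by (rule transpose_laplacian_mult_vec[OF p that])
    have "q $ j = 0" if "j < n" for j
      by (rule row_defect_zero_if_invariant[OF q_eq inv that])
    then show "transpose_mat ?L *\<^sub>v p = 0\<^sub>v n"
      unfolding q_def[symmetric] using q by (intro eq_vecI) auto
  qed
  have "Polynomial.order 0 (char_poly (transpose_mat ?L)) = kernel_dim (transpose_mat ?L)"
  proof (rule order_char_poly_eq_kernel_dim[OF c(2)], unfold transpose_transpose)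
    fix f assume f: "f \<in> carrier_vec n" and z: "?L *\<^sub>v (?L *\<^sub>v f) = 0\<^sub>v n"
    define g where "g = ?L *\<^sub>v f"
    have g: "g \<in> carrier_vec n" unfolding g_def by (rule mult_mat_vec_carrier[OF c(1) f])
    have harm: "(\<Sum>j<n. S i j * g $ j) = g $ i" if "i < n" for i
    proof -
      have "(laplacian *\<^sub>v g) $ i = 0" using z that by (simp add: g_def)
      with laplacian_mult_vec[OF g that] show ?thesis by linarith
    qed
    have g_eq: "g $ i = f $ i - (\<Sum>j<n. S i j * f $ j)" if "i < n" for i
      unfolding g_def by (rule laplacian_mult_vec[OF f that])
    have "g $ i = 0" if "i < n" for i
      by (rule column_defect_zero_if_harmonic[OF g_eq harm that])
    then show "?L *\<^sub>v f = 0\<^sub>v n"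
      unfolding g_def[symmetric] using g by (intro eq_vecI) auto
  qed
  then show "Polynomial.order 0 (char_poly ?L) = kernel_dim (transpose_mat ?L)"
    using char_poly_transpose_mat[OF c(1)] by simp
qed

section \<open>Closed communicating classes and the left kernel\<close>

text \<open>
  The invariant distribution of a class is positive somewhere on it, hence everywhere on it. One
  vertex \<open>c i\<close> of each class serves as the coordinate owned by \<open>\<gamma> i\<close>: if an invariant \<open>v\<close> were nonzero
  at some vertex of class \<open>i\<close>, positivity of \<open>|v|\<close> would spread to \<open>c i\<close>.
\<close>

lemma invariant_basis_of_closed_classes:
  assumes fin: "finite I"
    and closed: "\<And>i. i \<in> I \<Longrightarrow> closed_class (B i)"
    and nonempty: "\<And>i. i \<in> I \<Longrightarrow> B i \<noteq> {}"
    and communicating: "\<And>i u v. i \<in> I \<Longrightarrow> u \<in> B i \<Longrightarrow> v \<in> B i \<Longrightarrow> (u, v) \<in> transitions\<^sup>*"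
    and disjoint: "\<And>i j. i \<in> I \<Longrightarrow> j \<in> I \<Longrightarrow> i \<noteq> j \<Longrightarrow> B i \<inter> B j = {}"
    and absorbing: "\<And>v. v < n \<Longrightarrow> \<exists>i\<in>I. \<exists>u\<in>B i. (v, u) \<in> transitions\<^sup>*"
  obtains \<gamma> :: "'i \<Rightarrow> real vec" where "inj_on \<gamma> I" "\<And>i. i \<in> I \<Longrightarrow> \<gamma> i \<in> carrier_vec n"
    "kernel.basis n (transpose_mat laplacian) (\<gamma> ` I)"
    "\<And>i v. i \<in> I \<Longrightarrow> v < n \<Longrightarrow> 0 \<le> \<gamma> i $ v"
    "\<And>i v. i \<in> I \<Longrightarrow> v < n \<Longrightarrow> 0 < \<gamma> i $ v \<longleftrightarrow> v \<in> B i"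
    "\<And>i. i \<in> I \<Longrightarrow> (\<Sum>v<n. \<gamma> i $ v) = 1"
proof -
  have sub: "B i \<subseteq> {..<n}" if "i \<in> I" for i
    using closed[OF that] by (simp add: closed_class_def)
  have "\<exists>g. g \<in> carrier_vec n \<and> invariant (\<lambda>v. g $ v) \<and> (\<forall>v<n. 0 \<le> g $ v) \<and>
      (\<forall>v<n. 0 < g $ v \<longleftrightarrow> v \<in> B i) \<and> (\<Sum>v<n. g $ v) = 1" if i: "i \<in> I" for i
  proof -
    obtain q where q: "invariant q" "\<And>v. v < n \<Longrightarrow> 0 \<le> q v" "\<And>v. v < n \<Longrightarrow> v \<notin> B i \<Longrightarrow> q v = 0"
      "(\<Sum>v<n. q v) = 1"
      using exists_invariant_distribution[OF closed[OF i] nonempty[OF i]] by blast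
    then obtain a where a: "a < n" "q a \<noteq> 0"
      by (metis (mono_tags, lifting) lessThan_iff sum.neutral zero_neq_one)
    with q(2,3) have "0 < q a" "a \<in> B i" by (fastforce simp: less_le)+
    then have pos: "0 < q v" if "v \<in> B i" for v
      using invariant_pos_transitions[OF q(1,2) communicating[OF i]] that by blast
    have "0 < q v \<longleftrightarrow> v \<in> B i" if "v < n" for v
      using q(3)[OF that] pos[of v] by (cases "v \<in> B i") simp_all
    moreover have "invariant (\<lambda>v. vec n q $ v)"
      using q(1) by (simp add: invariant_def)
    ultimately show ?thesis
      using q(2,4) by (intro exI[of _ "vec n q"]) simp
  qed
  then have "\<forall>i\<in>I. \<exists>g. g \<in> carrier_vec n \<and> invariant (\<lambda>v. g $ v) \<and> (\<forall>v<n. 0 \<le> g $ v) \<and>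
      (\<forall>v<n. 0 < g $ v \<longleftrightarrow> v \<in> B i) \<and> (\<Sum>v<n. g $ v) = 1" by blast
  from bchoice[OF this] obtain \<gamma> where all: "\<forall>i\<in>I. \<gamma> i \<in> carrier_vec n \<and> invariant (\<lambda>v. \<gamma> i $ v) \<and>
      (\<forall>v<n. 0 \<le> \<gamma> i $ v) \<and> (\<forall>v<n. 0 < \<gamma> i $ v \<longleftrightarrow> v \<in> B i) \<and> (\<Sum>v<n. \<gamma> i $ v) = 1" ..
  have \<gamma>: "\<And>i. i \<in> I \<Longrightarrow> \<gamma> i \<in> carrier_vec n" "\<And>i. i \<in> I \<Longrightarrow> invariant (\<lambda>v. \<gamma> i $ v)"
    "\<And>i v. i \<in> I \<Longrightarrow> v < n \<Longrightarrow> 0 \<le> \<gamma> i $ v"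
    and supp: "\<And>i v. i \<in> I \<Longrightarrow> v < n \<Longrightarrow> 0 < \<gamma> i $ v \<longleftrightarrow> v \<in> B i"
    and sum1: "\<And>i. i \<in> I \<Longrightarrow> (\<Sum>v<n. \<gamma> i $ v) = 1"
    using all by blast+
  define c where "c i = (SOME v. v \<in> B i)" for i
  have c: "c i \<in> B i" "c i < n" if i: "i \<in> I" for i
  proof -
    show "c i \<in> B i" unfolding c_def using nonempty[OF i] by (rule some_in_eq[THEN iffD2])
    then show "c i < n" using sub[OF i] by auto
  qed
  have other: "\<gamma> j $ c i = 0" if "i \<in> I" "j \<in> I" "i \<noteq> j" for i j
    using disjoint[OF that] c[OF that(1)] supp[OF that(2)] \<gamma>(3)[OF that(2)]
    by (metis IntI empty_iff order_le_less)
  have diag: "0 < \<gamma> i $ c i" if "i \<in> I" for i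
    using supp c that by blast
  have inj: "inj_on \<gamma> I"
    by (rule inj_onI) (metis diag other less_irrefl)
  have basis: "kernel.basis n (transpose_mat laplacian) (\<gamma> ` I)"
  proof (rule kernel_basis_if_dual_coordinates[where nr = n and r = "\<lambda>x. c (inv_into I \<gamma> x)"])
    show "\<gamma> ` I \<subseteq> mat_kernel (transpose_mat laplacian)"
      using \<gamma> by (auto simp: mat_kernel_transpose_laplacian)
    show "v = 0\<^sub>v n"
      if v: "v \<in> mat_kernel (transpose_mat laplacian)"
        and zero: "\<And>x. x \<in> \<gamma> ` I \<Longrightarrow> v $ c (inv_into I \<gamma> x) = 0" for v
    proof -
      have v0: "v $ c i = 0" if "i \<in> I" for i
        using zero[of "\<gamma> i"] that inj by simp
      have vc: "v \<in> carrier_vec n" and "invariant (\<lambda>a. v $ a)"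
        using v by (simp_all add: mat_kernel_transpose_laplacian)
      then have inv: "invariant (\<lambda>a. \<bar>v $ a\<bar>)" by (intro invariant_abs)
      have zero_on: "v $ a = 0" if i: "i \<in> I" and a: "a \<in> B i" for i a
      proof (rule ccontr)
        assume "v $ a \<noteq> 0"
        then have "0 < \<bar>v $ c i\<bar>"
          using invariant_pos_transitions[OF inv _ communicating[OF i a c(1)[OF i]]] by simp
        with v0[OF i] show False by simp
      qed
      have "v $ a = 0" if a: "a < n" for a
      proof -
        obtain i u where i: "i \<in> I" "u \<in> B i" "(a, u) \<in> transitions\<^sup>*"
          using absorbing[OF a] by blast
        show ?thesis
        proof (cases "a \<in> B i")
          case False
          then have "\<bar>v $ a\<bar> = 0"
            using invariant_zero_outside_closed_class[OF inv _ closed[OF i(1)] a False i(3,2)] by simp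
          then show ?thesis by simp
        qed (use zero_on i in blast)
      qed
      then show ?thesis using vc by (intro eq_vecI) auto
    qed
  next
    fix x assume "x \<in> \<gamma> ` I"
    then obtain i where i: "i \<in> I" "x = \<gamma> i" by blast
    then have r: "inv_into I \<gamma> x = i" using inj by simp
    show "c (inv_into I \<gamma> x) < n" "x $ c (inv_into I \<gamma> x) \<noteq> 0"
      using c(2) diag i r by force+
    fix y assume "y \<in> \<gamma> ` I" "y \<noteq> x"
    then obtain j where "j \<in> I" "y = \<gamma> j" "i \<noteq> j" using i(2) by blast
    then show "y $ c (inv_into I \<gamma> x) = 0" using other i(1) r by simp
  qed (use fin in simp_all)
  show ?thesis
    by (rule that[OF inj \<gamma>(1) basis \<gamma>(3) supp sum1])
qed

end

section \<open>Cabals as the closed classes of the random walk\<close>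

context weighted_digraph
begin

sublocale walk: stochastic_matrix n "\<lambda>i j. random_walk_mat G n w $$ (i, j)"
proof
  fix i j assume i: "i < n" and j: "j < n"
  have "0 \<le> adjacency_mat G n w $$ (i, j)"
    using i j weight_pos[of j i] by (auto simp: adjacency_mat_def raw_adjacency_mat_def less_imp_le)
  then show "0 \<le> random_walk_mat G n w $$ (i, j)"
    using row_sum_pos[OF i] by (simp add: random_walk_mat_index[OF i j])
next
  fix i assume i: "i < n"
  have "(\<Sum>j<n. random_walk_mat G n w $$ (i, j)) =
      (\<Sum>j<n. adjacency_mat G n w $$ (i, j)) / (\<Sum>l<n. adjacency_mat G n w $$ (i, l))"
    by (simp add: random_walk_mat_index[OF i] sum_divide_distrib[symmetric])
  then show "(\<Sum>j<n. random_walk_mat G n w $$ (i, j)) = 1"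
    using row_sum_pos[OF i] by simp
qed

lemma random_walk_laplacian_eq: "random_walk_laplacian G n w = walk.laplacian"
proof -
  have cols: "dim_col (random_walk_mat G n w) = n"
    by (simp add: random_walk_mat_def adjacency_mat_def)
  \<comment> \<open>The number of rows is that of the inverse of the degree matrix, which has to be shown to exist.\<close>
  have rows: "dim_row (random_walk_mat G n w) = n"
  proof -
    let ?D = "degree_mat G n w"
    have D: "?D \<in> carrier_mat n n" by (simp add: degree_mat_def)
    have "upper_triangular ?D" by (auto simp: upper_triangular_def degree_mat_def)
    then have "det ?D = prod_list (diag_mat ?D)" using D by (rule det_upper_triangular)
    also have "\<dots> \<noteq> 0"
      using row_sum_pos by (fastforce simp: prod_list_zero_iff diag_mat_def degree_mat_def)
    finally have "?D \<in> Units (ring_mat TYPE(real) n ())"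
      by (rule det_non_zero_imp_unit[OF D])
    then obtain E where "mat_inverse ?D = Some E"
      using mat_inverse(1)[OF D, of "()"] by (cases "mat_inverse ?D") auto
    with mat_inverse(2)[OF D this] show ?thesis
      by (auto simp: random_walk_mat_def)
  qed
  show ?thesis
    by (intro eq_matI) (auto simp: rows cols random_walk_laplacian_def walk.laplacian_def)
qed

text \<open>
  Transitions reverse arcs; the only other transitions are the artificial loops at vertices without
  incoming arcs.
\<close>

lemma transitions_iff:
  "(i, j) \<in> walk.transitions \<longleftrightarrow> (j, i) \<in> parcs G \<or>
    (i = j \<and> i < n \<and> (\<forall>l. (l, i) \<notin> parcs G))"
proof (cases "i < n \<and> j < n")
  case True
  have row0: "row (raw_adjacency_mat G n w) i = 0\<^sub>v n \<longleftrightarrow> (\<forall>l. (l, i) \<notin> parcs G)"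
  proof -
    have "row (raw_adjacency_mat G n w) i = 0\<^sub>v n \<longleftrightarrow> (\<forall>l<n. (l, i) \<notin> parcs G)"
      using True weight_pos by (fastforce simp: vec_eq_iff raw_adjacency_mat_def)
    also have "\<dots> \<longleftrightarrow> (\<forall>l. (l, i) \<notin> parcs G)"
      using arc_fst_in_verts vertices by fastforce
    finally show ?thesis .
  qed
  have "(i, j) \<in> walk.transitions \<longleftrightarrow> 0 < adjacency_mat G n w $$ (i, j)"
    using True row_sum_pos[of i]
    by (simp add: walk.transitions_def random_walk_mat_index zero_less_divide_iff)
  then show ?thesis
    using True weight_pos by (auto simp: adjacency_mat_def row0) (auto simp: raw_adjacency_mat_def)
next
  case False
  then show ?thesis
    using arc_fst_in_verts[of "(j, i)"] arc_snd_in_verts[of "(j, i)"] vertices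
    by (auto simp: walk.transitions_def)
qed

lemma mem_reachable_set_iff: "i \<in> reachable_set G j \<longleftrightarrow> (j, i) \<in> (parcs G)\<^sup>*"
  by (auto simp: reachable_set_def rtrancl_eq_or_trancl)

lemma reachable_set_subset_pverts:
  assumes "j \<in> pverts G"
  shows "reachable_set G j \<subseteq> pverts G"
proof
  fix i assume "i \<in> reachable_set G j"
  then have "(j, i) \<in> (parcs G)\<^sup>*" by (simp add: mem_reachable_set_iff)
  then show "i \<in> pverts G"
    by (induction rule: rtrancl_induct) (use assms arc_snd_in_verts in force)+
qed

lemma reachable_set_mono:
  "i \<in> reachable_set G j \<Longrightarrow> reachable_set G i \<subseteq> reachable_set G j"
  by (auto simp: mem_reachable_set_iff)

lemma transitions_rtrancl_if_reachable:
  "i \<in> reachable_set G j \<Longrightarrow> (i, j) \<in> walk.transitions\<^sup>*"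
proof -
  assume "i \<in> reachable_set G j"
  then have "(i, j) \<in> ((parcs G)\<inverse>)\<^sup>*"
    by (simp add: mem_reachable_set_iff rtrancl_converse)
  moreover have "(parcs G)\<inverse> \<subseteq> walk.transitions" by (auto simp: transitions_iff)
  ultimately show ?thesis using rtrancl_mono by blast
qed

lemma reaches_maximal:
  "R \<in> reaches G \<Longrightarrow> v \<in> pverts G \<Longrightarrow> R \<subseteq> reachable_set G v \<Longrightarrow> reachable_set G v = R"
  by (auto simp: reaches_def)

lemma reaches_subset_pverts: "R \<in> reaches G \<Longrightarrow> R \<subseteq> pverts G"
  using reachable_set_subset_pverts by (auto simp: reaches_def)

text \<open>
  If \<open>j \<rightarrow> i\<close> with \<open>i\<close> a root of \<open>R\<close>, then everything in \<open>R\<close> is reachable from \<open>j\<close>, and maximality of \<open>R\<close>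
  makes \<open>j\<close> a root as well. An artificial loop stays where it is.
\<close>

lemma cabal_closed:
  assumes R: "R \<in> reaches G"
  shows "walk.closed_class (cabal G R)"
proof -
  have "j \<in> cabal G R" if i: "i \<in> cabal G R" and ji: "(j, i) \<in> parcs G" for i j
  proof -
    have "i \<in> reachable_set G j" using ji by (auto simp: mem_reachable_set_iff)
    then have "reachable_set G i \<subseteq> reachable_set G j" by (rule reachable_set_mono)
    then have "reachable_set G j = R"
      using reaches_maximal[OF R, of j] i arc_fst_in_verts[OF ji] by (simp add: cabal_def)
    then show ?thesis by (auto simp: cabal_def mem_reachable_set_iff)
  qed
  moreover have "cabal G R \<subseteq> {..<n}"
    using reaches_subset_pverts[OF R] vertices by (auto simp: cabal_def)
  ultimately show ?thesis by (auto simp: walk.closed_class_def transitions_iff)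
qed

lemma cabal_nonempty: "R \<in> reaches G \<Longrightarrow> cabal G R \<noteq> {}"
  by (auto simp: reaches_def cabal_def mem_reachable_set_iff)

lemma cabal_communicating:
  "u \<in> cabal G R \<Longrightarrow> v \<in> cabal G R \<Longrightarrow> (u, v) \<in> walk.transitions\<^sup>*"
  by (rule transitions_rtrancl_if_reachable) (simp add: cabal_def)

lemma cabal_disjoint: "R \<noteq> R' \<Longrightarrow> cabal G R \<inter> cabal G R' = {}"
  by (auto simp: cabal_def)

text \<open>
  A maximal one among the finitely many reachable sets that contain \<open>v\<close> is a reach, because any
  larger reachable set would contain \<open>v\<close> too; the walk goes from \<open>v\<close> back to its root.
\<close>

lemma cabal_absorbing:
  assumes v: "v < n"
  shows "\<exists>R\<in>reaches G. \<exists>u\<in>cabal G R. (v, u) \<in> walk.transitions\<^sup>*"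
proof -
  let ?F = "{R \<in> reachable_set G ` pverts G. v \<in> R}"
  have "finite ?F" "reachable_set G v \<in> ?F"
    using v by (auto simp: vertices mem_reachable_set_iff)
  from finite_has_maximal2[OF this] obtain R
    where R: "R \<in> ?F" and max: "\<forall>R'\<in>?F. R \<subseteq> R' \<longrightarrow> R = R'" by blast
  then obtain u where u: "u \<in> pverts G" "R = reachable_set G u" "v \<in> R" by blast
  have "R \<in> reaches G"
    unfolding reaches_def
  proof (intro CollectI conjI ballI notI)
    fix v' assume "v' \<in> pverts G" "R \<subset> reachable_set G v'"
    with u(3) max show False by blast
  qed (use R in blast)
  moreover have "u \<in> cabal G R"
    using u by (simp add: cabal_def mem_reachable_set_iff)
  ultimately show ?thesis
    using transitions_rtrancl_if_reachable u by blast
qed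

lemma n_pos: "0 < n"
  using weakly_connected vertices by (auto simp: connected_def strongly_connected_def)

end

section \<open>Kernel and multiplicities for the random walk Laplacian\<close>

theorem theorem4p4:
  fixes G :: "nat pair_pre_digraph" and n k :: nat and w :: "nat \<Rightarrow> nat \<Rightarrow> real"
    and R B :: "nat \<Rightarrow> nat set" and L :: "real mat"
  assumes "weighted_digraph G n w"
    and "L = random_walk_laplacian G n w"
    and "bij_betw R {1..k} (reaches G)"
    and "\<forall>i\<in>{1..k}. B i = cabal G (R i)"
  shows "eigenvalue L 0 \<and> algebraic_multiplicity L 0 = k \<and> geometric_multiplicity L 0 = k \<and>
    (\<exists>\<gamma> :: nat \<Rightarrow> real vec.
       inj_on \<gamma> {1..k} \<and> is_left_kernel_basis L (\<gamma> ` {1..k}) \<and>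
       (\<forall>i\<in>{1..k}. \<forall>v\<in>{0..<n}. \<gamma> i $ v \<ge> 0) \<and>
       (\<forall>i\<in>{1..k}. vec_supp (\<gamma> i) = B i) \<and>
       (\<forall>i\<in>{1..k}. (\<Sum>v\<in>{0..<n}. \<gamma> i $ v) = 1) \<and>
       (\<forall>i\<in>{1..k}. \<forall>j\<in>{1..k}. i \<noteq> j \<longrightarrow> \<gamma> i \<bullet> \<gamma> j = 0))"
proof -
  interpret weighted_digraph G n w by fact
  have L: "L = walk.laplacian" using assms(2) random_walk_laplacian_eq by simp
  have Lc: "L \<in> carrier_mat n n" by (simp add: L)
  have reach: "R i \<in> reaches G" if "i \<in> {1..k}" for i
    using assms(3) that by (auto simp: bij_betw_def)
  have B: "B i = cabal G (R i)" if "i \<in> {1..k}" for i using assms(4) that by blast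
  have Bsub: "B i \<subseteq> {..<n}" if "i \<in> {1..k}" for i
    using cabal_closed[OF reach[OF that]] B[OF that] by (simp add: walk.closed_class_def)
  have disj: "B i \<inter> B j = {}" if "i \<in> {1..k}" "j \<in> {1..k}" "i \<noteq> j" for i j
  proof -
    have "R i \<noteq> R j"
      using inj_onD[OF bij_betw_imp_inj_on[OF assms(3)] _ that(1,2)] that(3) by blast
    then show ?thesis unfolding B[OF that(1)] B[OF that(2)] by (rule cabal_disjoint)
  qed
  obtain \<gamma> :: "nat \<Rightarrow> real vec" where \<gamma>: "inj_on \<gamma> {1..k}" "\<And>i. i \<in> {1..k} \<Longrightarrow> \<gamma> i \<in> carrier_vec n"
    and basis: "kernel.basis n (transpose_mat L) (\<gamma> ` {1..k})"
    and nonneg: "\<And>i v. i \<in> {1..k} \<Longrightarrow> v < n \<Longrightarrow> 0 \<le> \<gamma> i $ v"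
    and supp: "\<And>i v. i \<in> {1..k} \<Longrightarrow> v < n \<Longrightarrow> 0 < \<gamma> i $ v \<longleftrightarrow> v \<in> B i"
    and sum1: "\<And>i. i \<in> {1..k} \<Longrightarrow> (\<Sum>v<n. \<gamma> i $ v) = 1"
  proof (rule walk.invariant_basis_of_closed_classes[of "{1..k}" B])
    show "\<exists>i\<in>{1..k}. \<exists>u\<in>B i. (v, u) \<in> walk.transitions\<^sup>*" if "v < n" for v
      using cabal_absorbing[OF that] B unfolding bij_betw_imp_surj_on[OF assms(3), symmetric] by fastforce
  next
    fix i assume i: "i \<in> {1..k}"
    show "walk.closed_class (B i)" "B i \<noteq> {}"
      unfolding B[OF i] using cabal_closed cabal_nonempty reach[OF i] by blast+
    show "(u, v) \<in> walk.transitions\<^sup>*" if "u \<in> B i" "v \<in> B i" for u v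
      using cabal_communicating that unfolding B[OF i] by blast
  qed (use disj L in blast)+
  have dim: "kernel_dim (transpose_mat L) = k"
  proof -
    interpret K: kernel n n "transpose_mat L" by unfold_locales (use Lc in simp)
    show ?thesis
      using K.Ker.dim_basis[OF _ basis] \<gamma>(1) by (simp add: card_image)
  qed
  then have order: "Polynomial.order 0 (char_poly L) = k"
    and geo: "kernel_dim L = k"
    using walk.order_char_poly_laplacian by (simp_all add: L)
  have "0 < k"
    using cabal_absorbing[OF n_pos] assms(3) by (cases k) (auto simp: bij_betw_def)
  then have "poly (char_poly L) 0 = 0"
    using order by (metis order_0I less_irrefl)
  then have "eigenvalue L 0" by (simp add: eigenvalue_root_char_poly[OF Lc])
  moreover have "algebraic_multiplicity L 0 = k" "geometric_multiplicity L 0 = k"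
    using order geo by (simp_all add: algebraic_multiplicity_def geometric_multiplicity_def char_matrix_zero[OF Lc])
  moreover have "is_left_kernel_basis L (\<gamma> ` {1..k})"
    using basis Lc by (simp add: is_left_kernel_basis_iff)
  moreover have "vec_supp (\<gamma> i) = B i" if i: "i \<in> {1..k}" for i
    using supp[OF i] Bsub[OF i] \<gamma>(2)[OF i] by (auto simp: vec_supp_def)
  moreover have "\<gamma> i \<bullet> \<gamma> j = 0" if ij: "i \<in> {1..k}" "j \<in> {1..k}" "i \<noteq> j" for i j
  proof -
    have "\<gamma> i $ v * \<gamma> j $ v = 0" if v: "v < n" for v
    proof -
      have "v \<notin> B i \<or> v \<notin> B j" using disj[OF ij] by blast
      then have "\<gamma> i $ v = 0 \<or> \<gamma> j $ v = 0"
        using supp nonneg ij v by (metis order_le_less)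
      then show ?thesis by simp
    qed
    then show ?thesis using \<gamma>(2)[OF ij(2)] unfolding scalar_prod_def by (intro sum.neutral) auto
  qed
  ultimately show ?thesis
    unfolding atLeast0LessThan using \<gamma>(1) nonneg sum1
    by (intro conjI exI[of _ \<gamma>] ballI impI) (blast | simp)+
qed

end
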